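(* Let a dumbbell and point mass be in a colinear overlapped relative equilibrium (RE), that is, an RE of the planar dumbbell/point mass problem with $\theta=0$ and $0<r<x_2$. Write $R=\frac{r}{x_2-r}\in(0,\infty)$, so $r=x_2\frac{R}{R+1}$, and regard the square $L^2$ of the angular momentum of the RE as a function $L^2(R)$. (i) For $x_1<x_2$, with $x_1$ sufficiently large, we have $(L^2)'(R)<0$ for all $R$, and therefore only one RE for each $L^2$. (ii) However, for $x_1\ll x_2$, we have $(L^2)'>0$ for one interval (of values of $R$), and therefore three RE for some interval of $L^2$ values, and one RE otherwise.
   Context: Planar dumbbell/point mass problem: a point mass body of mass $M_1$ and a dumbbell of total mass $M_2=1-M_1$ move in a plane under Newtonian gravity ($G=1$), with $M_1,M_2>0$. The dumbbell consists of two point masses $M_2x_1$, $M_2x_2$ ($x_1+x_2=1$, $x_i>0$) joined by a massless rod of length $1$. Let $\vec r$ be the vector from the point mass body to the dumbbell's center of mass, $r=|\vec r|>0$, and $\theta$ the angle between $\vec r$ and the rod, where for $\theta=0$ the mass with ratio $x_1$ is the one lying on the side of the system's center of mass (toward the point mass body). The distances from the point mass body to the dumbbell masses are $d_1=\sqrt{r^2-2x_2r\cos\theta+x_2^2}$ and $d_2=\sqrt{r^2+2x_1r\cos\theta+x_1^2}$. Put $B=\frac{x_1x_2}{M_1}$. The (scaled) amended potential for angular momentum $L$ is $$V(r,\theta)=\frac{L^2}{2(r^2+B)}-\frac{x_1}{d_1}-\frac{x_2}{d_2}.$$ A relative equilibrium (RE) with angular momentum $L$ is a critical point $(r,\theta)$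 of $V$. "Overlapped" means $r<x_2$, so that the point mass body lies on the massless rod. For $\theta=0$ and $0<r<x_2$ the condition $\partial_\theta V=0$ holds automatically, and $\partial_rV=0$ is equivalent to $L^2=L^2(R)$, where with $r=x_2\frac{R}{R+1}$ $$L^2(R)=\frac{(r^2+B)^2}{r}\left(\frac{x_2}{(r+x_1)^2}-\frac{x_1}{(x_2-r)^2}\right).$$ The prime denotes $\frac{d}{dR}$.
   Formalization: In (ii), "one RE otherwise" fails at the two endpoints of the interval of L^2 values, where exactly two distinct RE exist; the formal statement gives three RE inside the open interval, two at its endpoints, and one for all other L^2 ≥ 0. *)

theory Defs
  imports "HOL-Analysis.Analysis"
begin

definition dist1 :: "real \<Rightarrow> real \<Rightarrow> real \<Rightarrow> real" where
  "dist1 x2 r \<theta> = sqrt (r\<^sup>2 - 2 * x2 * r * cos \<theta> + x2\<^sup>2)"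

definition dist2 :: "real \<Rightarrow> real \<Rightarrow> real \<Rightarrow> real" where
  "dist2 x1 r \<theta> = sqrt (r\<^sup>2 + 2 * x1 * r * cos \<theta> + x1\<^sup>2)"

definition inertia_B :: "real \<Rightarrow> real \<Rightarrow> real \<Rightarrow> real" where
  "inertia_B M1 x1 x2 = x1 * x2 / M1"

definition amended_potential ::
    "real \<Rightarrow> real \<Rightarrow> real \<Rightarrow> real \<Rightarrow> real \<Rightarrow> real \<Rightarrow> real" where
  "amended_potential M1 x1 x2 L r \<theta> =
     L\<^sup>2 / (2 * (r\<^sup>2 + inertia_B M1 x1 x2)) - x1 / dist1 x2 r \<theta> - x2 / dist2 x1 r \<theta>"

text \<open>
  Critical points of the amended potential. Collisions (\<open>dist1 = 0\<close> or \<open>dist2 = 0\<close>) are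
  excluded automatically: there the potential is discontinuous, hence not differentiable.
\<close>

definition relative_equilibrium ::
    "real \<Rightarrow> real \<Rightarrow> real \<Rightarrow> real \<Rightarrow> real \<times> real \<Rightarrow> bool" where
  "relative_equilibrium M1 x1 x2 L p \<longleftrightarrow>
     fst p > 0 \<and>
     ((\<lambda>(r, \<theta>). amended_potential M1 x1 x2 L r \<theta>) has_derivative (\<lambda>_. 0)) (at p)"

text \<open>
  The angle is a real number here, so \<open>\<theta> = 0\<close> picks exactly one representative of the
  configuration modulo \<open>2 * pi\<close>, and counting elements of this set counts configurations.
\<close>

definition colinear_overlapped_RE ::
    "real \<Rightarrow> real \<Rightarrow> real \<Rightarrow> real \<Rightarrow> (real \<times> real) set" where
  "colinear_overlapped_RE M1 x1 x2 L =
     {(r, \<theta>). relative_equilibrium M1 x1 x2 L (r, \<theta>) \<and> \<theta> = 0 \<and> r < x2}"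

text \<open>
  The squared angular momentum of the colinear overlapped relative equilibrium with
  \<open>R = r / (x2 - r)\<close>. The formula may be negative, in which case the position
  \<open>r\<close> is not a relative equilibrium for any real angular momentum.
\<close>

definition L_sq :: "real \<Rightarrow> real \<Rightarrow> real \<Rightarrow> real \<Rightarrow> real" where
  "L_sq M1 x1 x2 R =
     (let r = x2 * (R / (R + 1))
      in (r\<^sup>2 + inertia_B M1 x1 x2)\<^sup>2 / r * (x2 / (r + x1)\<^sup>2 - x1 / (x2 - r)\<^sup>2))"

end

theory Submission
  imports Defs "HOL-Real_Asymp.Real_Asymp"
begin

text \<open>
  With \<open>x = x1\<close> and \<open>m = 1 / M1\<close>, the function \<open>L_sq\<close> is the rational function
  \<open>N\<^sup>2 * P / ((1 - x) * R * (R + 1) * (R + x)\<^sup>2)\<close> with \<open>N\<close>, \<open>P\<close> quadratic in \<open>R\<close>. Its derivative is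
  a positive multiple of a polynomial of degree 6 in \<open>R\<close>, all of whose coefficients except the
  one of \<open>R ^ 3\<close> are negative for every \<open>0 < x < 1/2\<close>. Near \<open>x = 1/2\<close> the cubic coefficient is
  negative as well, so \<open>L_sq\<close> decreases from \<open>+\<infinity>\<close> to \<open>-\<infinity>\<close>. As \<open>x\<close> tends to 0 the polynomial
  tends to \<open>R ^ 3\<close>; being \<open>R ^ 3\<close> times a concave function, it is then positive on exactly one
  interval around 1, and \<open>L_sq\<close> decreases, increases and decreases again.
\<close>

section \<open>Counting the solutions of \<open>f r = t\<close> on the half line\<close>

lemma ex1_level_decreasing:
  fixes f :: "real \<Rightarrow> real"
  assumes cont: "continuous_on {a..b} f" and "a \<le> b"
    and dec: "\<And>u v. a \<le> u \<Longrightarrow> u < v \<Longrightarrow> v \<le> b \<Longrightarrow> f v < f u"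
    and "f b \<le> t" "t \<le> f a"
  shows "\<exists>!u. a \<le> u \<and> u \<le> b \<and> f u = t"
proof -
  have "\<exists>u. a \<le> u \<and> u \<le> b \<and> f u = t"
    using IVT2'[of f b t a] assms by auto
  moreover have "u = v" if "a \<le> u \<and> u \<le> b \<and> f u = t" "a \<le> v \<and> v \<le> b \<and> f v = t" for u v
    using that dec[of u v] dec[of v u] by (cases u v rule: linorder_cases) auto
  ultimately show ?thesis by blast
qed

text \<open>The boundary behaviour of \<open>L_sq\<close>: values run from plus infinity at 0 to
  minus infinity at infinity. Every level is therefore attained; how often depends on
  monotonicity.\<close>

locale half_line_profile =
  fixes f :: "real \<Rightarrow> real"
  assumes cont: "continuous_on {0<..} f"
    and top: "filterlim f at_top (at_right 0)"
    and bot: "filterlim f at_bot at_top"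
begin

lemma large_near_0:
  assumes "p > 0"
  obtains u where "0 < u" "u < p" "t < f u"
proof -
  have "eventually (\<lambda>u. t < f u) (at_right 0)"
    using top by (simp add: filterlim_at_top_dense)
  moreover have "eventually (\<lambda>u. u \<in> {0<..<p}) (at_right 0)"
    using assms eventually_at_right_real by blast
  ultimately have "eventually (\<lambda>u. t < f u \<and> u \<in> {0<..<p}) (at_right 0)"
    by (rule eventually_conj)
  from eventually_happens[OF this] show thesis using that by auto
qed

lemma small_at_infinity:
  obtains u where "q < u" "f u < t"
proof -
  have "eventually (\<lambda>u. f u < t) at_top"
    using bot by (simp add: filterlim_at_bot_dense)
  moreover have "eventually (\<lambda>u. q < u) at_top"
    by (rule eventually_gt_at_top)
  ultimately have "eventually (\<lambda>u. f u < t \<and> q < u) at_top"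
    by (rule eventually_conj)
  from eventually_happens[OF this] show thesis using that by auto
qed

text \<open>The limit at 0 supplies a point with value above \<open>t\<close>, which reduces
  existence to the compact interval between it and \<open>p\<close>.\<close>

lemma level_left:
  assumes "p > 0" and dec: "\<And>u v. 0 < u \<Longrightarrow> u < v \<Longrightarrow> v \<le> p \<Longrightarrow> f v < f u"
    and "f p \<le> t"
  obtains u where "{r. 0 < r \<and> r \<le> p \<and> f r = t} = {u}"
proof -
  obtain w where w: "0 < w" "w < p" "t < f w" using large_near_0[OF \<open>p > 0\<close>] .
  have "continuous_on {w..p} f"
    by (rule continuous_on_subset[OF cont]) (use w in auto)
  then have "\<exists>!u. w \<le> u \<and> u \<le> p \<and> f u = t"
    by (rule ex1_level_decreasing) (use w dec \<open>f p \<le> t\<close> in auto)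
  then obtain u where u: "w \<le> u" "u \<le> p" "f u = t" by blast
  have "r = u" if "0 < r" "r \<le> p" "f r = t" for r
    using dec[of u r] dec[of r u] that u w(1) by (cases u r rule: linorder_cases) simp_all
  then have "{r. 0 < r \<and> r \<le> p \<and> f r = t} = {u}"
    using u less_le_trans[OF w(1)] by blast
  then show thesis by (rule that)
qed

lemma level_right:
  assumes "q > 0" and dec: "\<And>u v. q \<le> u \<Longrightarrow> u < v \<Longrightarrow> f v < f u"
    and "t \<le> f q"
  obtains u where "{r. q \<le> r \<and> f r = t} = {u}"
proof -
  obtain w where w: "q < w" "f w < t" using small_at_infinity .
  have "continuous_on {q..w} f"
    by (rule continuous_on_subset[OF cont]) (use \<open>q > 0\<close> in auto)
  then have "\<exists>!u. q \<le> u \<and> u \<le> w \<and> f u = t"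
    by (rule ex1_level_decreasing) (use w dec \<open>t \<le> f q\<close> in auto)
  then obtain u where u: "q \<le> u" "u \<le> w" "f u = t" by blast
  have "r = u" if "q \<le> r" "f r = t" for r
    using dec[of u r] dec[of r u] that u(1,3) by (cases u r rule: linorder_cases) simp_all
  then have "{r. q \<le> r \<and> f r = t} = {u}" using u by blast
  then show thesis by (rule that)
qed

text \<open>Beyond a point \<open>q\<close> with \<open>f q < t\<close> the values stay below
  \<open>t\<close>, so all solutions lie in \<open>(0, q]\<close>, the situation of
  \<open>level_left\<close>.\<close>

lemma card_level_decreasing:
  assumes dec: "\<And>u v. 0 < u \<Longrightarrow> u < v \<Longrightarrow> f v < f u"
  shows "card {r. 0 < r \<and> f r = t} = 1"
proof -
  obtain q where q: "q > 1" "f q < t" using small_at_infinity .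
  have "f q \<le> t" using q by simp
  then obtain u where u: "{r. 0 < r \<and> r \<le> q \<and> f r = t} = {u}"
    using level_left[of q t] q dec by auto
  have "r \<le> q" if "f r = t" for r
    using q dec[of q r] that by (cases "r \<le> q") auto
  then have "{r. 0 < r \<and> f r = t} = {r. 0 < r \<and> r \<le> q \<and> f r = t}"
    by auto
  then show ?thesis by (simp add: u)
qed

text \<open>The half line splits into three monotone branches that share the turning points
  \<open>p\<close> and \<open>q\<close>. A level strictly between \<open>f p\<close> and
  \<open>f q\<close> meets each branch once; at a turning value two of the three solutions coincide;
  beyond these values one outer branch remains.\<close>

lemma card_level_N_shaped:
  assumes "0 < p" "p < q"
    and dec_left: "\<And>u v. 0 < u \<Longrightarrow> u < v \<Longrightarrow> v \<le> p \<Longrightarrow> f v < f u"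
    and inc: "\<And>u v. p \<le> u \<Longrightarrow> u < v \<Longrightarrow> v \<le> q \<Longrightarrow> f u < f v"
    and dec_right: "\<And>u v. q \<le> u \<Longrightarrow> u < v \<Longrightarrow> f v < f u"
  shows "f p < t \<Longrightarrow> t < f q \<Longrightarrow> card {r. 0 < r \<and> f r = t} = 3"
    and "t = f p \<or> t = f q \<Longrightarrow> card {r. 0 < r \<and> f r = t} = 2"
    and "t < f p \<or> f q < t \<Longrightarrow> card {r. 0 < r \<and> f r = t} = 1"
proof -
  have pq: "f p < f q" using inc \<open>p < q\<close> by simp
  let ?A = "{r. 0 < r \<and> r \<le> p \<and> f r = t}"
    and ?B = "{r. p \<le> r \<and> r \<le> q \<and> f r = t}"
    and ?C = "{r. q \<le> r \<and> f r = t}"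
  have split: "{r. 0 < r \<and> f r = t} = ?A \<union> ?B \<union> ?C"
    using \<open>0 < p\<close> \<open>p < q\<close> by auto
  have A0: "?A = {}" if "t < f p"
  proof -
    have "t < f r" if "0 < r" "r \<le> p" for r
      using dec_left[of r p] \<open>t < f p\<close> that by (cases "r = p") auto
    then show ?thesis by force
  qed
  have C0: "?C = {}" if "f q < t"
  proof -
    have "f r < t" if "q \<le> r" for r
      using dec_right[of q r] \<open>f q < t\<close> that by (cases "r = q") auto
    then show ?thesis by force
  qed
  have B0: "?B = {}" if "t < f p \<or> f q < t"
  proof -
    have "f p \<le> f r \<and> f r \<le> f q" if "p \<le> r" "r \<le> q" for r
      using inc[of p r] inc[of r q] that by (cases "r = p"; cases "r = q") (auto simp: less_imp_le)
    then show ?thesis using that by force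
  qed
  have A1: "\<exists>u. ?A = {u}" if "f p \<le> t"
    using level_left[OF \<open>0 < p\<close> dec_left that] by metis
  have C1: "\<exists>u. ?C = {u}" if "t \<le> f q"
    using level_right[of q t] dec_right that \<open>0 < p\<close> \<open>p < q\<close> by (metis less_trans)
  have B1: "\<exists>u. ?B = {u}" if "f p \<le> t" "t \<le> f q"
  proof -
    \<comment> \<open>Negation turns the increasing branch into a decreasing one, so that
      \<open>ex1_level_decreasing\<close> applies.\<close>
    have "continuous_on {p..q} (\<lambda>r. - f r)"
      by (intro continuous_on_minus continuous_on_subset[OF cont]) (use \<open>0 < p\<close> in auto)
    then have "\<exists>!u. p \<le> u \<and> u \<le> q \<and> - f u = - t"
      by (rule ex1_level_decreasing) (use inc \<open>p < q\<close> that in auto)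
    then show ?thesis by auto
  qed
  show "card {r. 0 < r \<and> f r = t} = 3" if t: "f p < t" "t < f q"
  proof -
    obtain u v w where uvw: "?A = {u}" "?B = {v}" "?C = {w}"
      using A1[OF less_imp_le] B1[OF less_imp_le less_imp_le] C1[OF less_imp_le] t by blast
    then have "u \<in> ?A" "v \<in> ?B" "w \<in> ?C" by (metis insertI1)+
    then have *: "u \<le> p" "p \<le> v" "v \<le> q" "q \<le> w" "f u = t" "f v = t" "f w = t" by auto
    \<comment> \<open>The strict bounds on \<open>t\<close> keep the middle solution off the shared
      turning points, which separates the three solutions.\<close>
    then have "v \<noteq> p" "v \<noteq> q" using t by auto
    then have "u \<noteq> v" "v \<noteq> w" "u \<noteq> w" using * by linarith+
    then show ?thesis unfolding split uvw by simp
  qed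
  show "card {r. 0 < r \<and> f r = t} = 2" if "t = f p \<or> t = f q"
    using that
  proof
    assume t: "t = f p"
    obtain u v w where uvw: "?A = {u}" "?B = {v}" "?C = {w}"
      using A1 B1 C1 pq unfolding t by (auto simp: less_imp_le)
    \<comment> \<open>The turning point \<open>p\<close> lies on both adjoining branches, so their
      single solutions are the same point.\<close>
    moreover have "p \<in> ?A" "p \<in> ?B" using t \<open>0 < p\<close> \<open>p < q\<close> by auto
    ultimately have eq: "?A = {p}" "?B = {p}" by auto
    have "w \<in> ?C" using uvw by blast
    then have "p \<noteq> w" using \<open>p < q\<close> by auto
    then show ?thesis unfolding split eq uvw(3) by simp
  next
    assume t: "t = f q"
    obtain u v w where uvw: "?A = {u}" "?B = {v}" "?C = {w}"
      using A1 B1 C1 pq unfolding t by (auto simp: less_imp_le)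
    moreover have "q \<in> ?B" "q \<in> ?C" using t \<open>p < q\<close> by auto
    ultimately have eq: "?B = {q}" "?C = {q}" by auto
    have "u \<in> ?A" using uvw by blast
    then have "u \<noteq> q" using \<open>p < q\<close> by auto
    then show ?thesis unfolding split eq uvw(1) by simp
  qed
  show "card {r. 0 < r \<and> f r = t} = 1" if "t < f p \<or> f q < t"
  proof -
    have B: "?B = {}" using that by (rule B0)
    have "?A = {} \<and> (\<exists>w. ?C = {w}) \<or> (\<exists>w. ?A = {w}) \<and> ?C = {}"
    proof (cases "t < f p")
      case True
      then have "t \<le> f q" using pq by simp
      then show ?thesis using A0 C1 True by blast
    next
      case False
      then have "f p \<le> t" "f q < t" using that pq by auto
      then show ?thesis using A1 C0 by blast
    qed
    then obtain w where "?A \<union> ?B \<union> ?C = {w}" using B by auto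
    then show ?thesis by (simp add: split)
  qed
qed

end

section \<open>Zeros and signs of a convex function\<close>

text \<open>Convexity compares values with chords. Between a zero and \<open>v\<close> the graph
  lies below a chord with end values 0 and \<open>f v < 0\<close>. Outside, the zero lies under the
  chord from \<open>r\<close> to \<open>v\<close>, whose height there is thus nonnegative, and this
  forces \<open>f r > 0\<close>.\<close>

lemma convex_sign_pattern:
  fixes f :: "real \<Rightarrow> real"
  assumes "convex_on {0<..} f" and cont: "continuous_on {0<..} f"
    and "0 < u" "u < v" "v < w" and "f u > 0" "f v < 0" "f w > 0"
  obtains p q where "0 < p" "p < v" "v < q" "f p = 0" "f q = 0"
    "\<And>r. p < r \<Longrightarrow> r < q \<Longrightarrow> f r < 0"
    "\<And>r. 0 < r \<Longrightarrow> r < p \<Longrightarrow> f r > 0"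
    "\<And>r. q < r \<Longrightarrow> f r > 0"
proof -
  have "\<exists>p\<ge>u. p \<le> v \<and> f p = 0"
    by (rule IVT2') (use assms in \<open>auto intro: continuous_on_subset[OF cont]\<close>)
  then obtain p where p: "u \<le> p" "p \<le> v" "f p = 0" by blast
  have "\<exists>q\<ge>v. q \<le> w \<and> f q = 0"
    by (rule IVT') (use assms in \<open>auto intro: continuous_on_subset[OF cont]\<close>)
  then obtain q where q: "v \<le> q" "q \<le> w" "f q = 0" by blast
  have less: "p < v" "v < q" using p q assms by (auto simp: less_le)
  \<comment> \<open>The chord inequality for three points with denominators cleared;
    \<open>s\<close> is the weight of \<open>c\<close> in \<open>b\<close>.\<close>
  have below: "(c - a) * f b \<le> (c - b) * f a + (b - a) * f c"
    if "0 < a" "a < b" "b < c" for a b c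
  proof -
    define s where "s = (b - a) / (c - a)"
    have s: "0 \<le> s" "s \<le> 1" using that by (auto simp: s_def)
    have s_mult: "(c - a) * s = b - a" using that by (simp add: s_def)
    have b: "b = (1 - s) * a + s * c" using s_mult by (simp add: algebra_simps)
    have "f b \<le> (1 - s) * f a + s * f c"
      unfolding b using convex_onD[OF assms(1) s, of a c] that by simp
    then have "(c - a) * f b \<le> (c - a) * ((1 - s) * f a + s * f c)"
      using that by (intro mult_left_mono) auto
    also have "\<dots> = (c - a - (c - a) * s) * f a + (c - a) * s * f c"
      by (simp add: algebra_simps)
    also have "\<dots> = (c - b) * f a + (b - a) * f c"
      by (simp add: s_mult)
    finally show ?thesis .
  qed
  have neg: "f r < 0" if "p < r" "r < q" for r
  proof (cases r v rule: linorder_cases)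
    case less
    with below[of p r v] that p assms have "(v - p) * f r \<le> (r - p) * f v" by auto
    also have "\<dots> < 0" using that assms by (auto intro: mult_pos_neg)
    finally show ?thesis using \<open>p < v\<close> by (simp add: mult_less_0_iff)
  next
    case greater
    with below[of v r q] that q assms have "(q - v) * f r \<le> (q - r) * f v" by auto
    also have "\<dots> < 0" using that assms by (auto intro: mult_pos_neg)
    finally show ?thesis using \<open>v < q\<close> by (simp add: mult_less_0_iff)
  qed (use assms in simp)
  have left: "f r > 0" if "0 < r" "r < p" for r
  proof -
    from below[of r p v] that p less have "0 \<le> (v - p) * f r + (p - r) * f v" by auto
    moreover have "(p - r) * f v < 0" using that assms by (auto intro: mult_pos_neg)
    ultimately have "0 < (v - p) * f r" by linarith
    then show ?thesis using \<open>p < v\<close> by (simp add: zero_less_mult_iff)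
  qed
  have right: "f r > 0" if "q < r" for r
  proof -
    from below[of v q r] that q less assms have "0 \<le> (r - q) * f v + (q - v) * f r" by auto
    moreover have "(r - q) * f v < 0" using that assms by (auto intro: mult_pos_neg)
    ultimately have "0 < (q - v) * f r" by linarith
    then show ?thesis using \<open>v < q\<close> by (simp add: zero_less_mult_iff)
  qed
  show thesis
    by (rule that[of p q]) (use p q less neg left right assms in auto)
qed

section \<open>The polynomial that carries the sign of the derivative\<close>

text \<open>With \<open>m = 1 / M1\<close> and \<open>x = x1\<close>, the quantity
  \<open>r^2 + B\<close> equals \<open>(1 - x) * N_poly m x R / (R + 1)^2\<close>.\<close>

definition N_poly :: "real \<Rightarrow> real \<Rightarrow> real \<Rightarrow> real" where
  "N_poly m x R = (1 - x) * R\<^sup>2 + m * x * (R + 1)\<^sup>2"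

text \<open>Up to a positive factor this is the difference of attractions
  \<open>x2 / (r + x1)^2 - x1 / (x2 - r)^2\<close>; it fixes the sign of
  \<open>L_sq\<close>.\<close>

definition P_poly :: "real \<Rightarrow> real \<Rightarrow> real" where
  "P_poly x R = (1 - x) ^ 3 - x * (R + x)\<^sup>2"

text \<open>The coefficient of \<open>R ^ 3\<close> in \<open>slope_poly\<close>, kept apart because
  its sign varies with \<open>x\<close>; it enters \<open>slope_coeff\<close> negated.\<close>

definition slope_coeff3 :: "real \<Rightarrow> real \<Rightarrow> real" where
  "slope_coeff3 m x = 1 - 2*x - 2*x^2 - x^3 + 4*x^5 - m*x*(3 - 12*x + 15*x^2 + 4*x^4)"

text \<open>The coefficients of the negated polynomial, factored to expose their signs for
  \<open>0 < x < 1/2\<close>.\<close>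

definition slope_coeff :: "real \<Rightarrow> real \<Rightarrow> nat \<Rightarrow> real" where
  "slope_coeff m x i =
     [m * x\<^sup>2 * ((1 - 2*x) * (1 - x + x\<^sup>2)),
      3 * m * x * ((1 - 2*x) * (1 - x + x\<^sup>2)),
      3 * x * (1 - 2*x) * (m * (2 - 3*x + 2*x\<^sup>2 - x^3) - (1 - x) * (1 - x + x\<^sup>2)),
      - slope_coeff3 m x,
      3 * x\<^sup>2 * ((1 - x) * (3 + 2*x) + m * x * (3 + 2*x)),
      3 * x * ((1 - x) * (1 + 2*x) + m * x * (1 + 2*x)),
      2 * x * (1 - x) + 2 * m * x\<^sup>2] ! i"

text \<open>What remains of the numerator of the derivative of \<open>L_sq\<close> once the positive
  factor \<open>N_poly m x R * (R + x)\<close> is split off.\<close>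

definition slope_poly :: "real \<Rightarrow> real \<Rightarrow> real \<Rightarrow> real" where
  "slope_poly m x R = - (\<Sum>i\<le>6. slope_coeff m x i * R ^ i)"

lemma sum_atMost_6: "(\<Sum>i\<le>6. f i) = f 0 + f 1 + f 2 + f 3 + f 4 + f 5 + f (6::nat)" for f :: "nat \<Rightarrow> real"
  by (simp add: eval_nat_numeral)

text \<open>The right-hand side is the form produced by the quotient rule. It is expanded in stages:
  \<open>E\<close> gathers the terms multiplied by \<open>P_poly\<close>, \<open>W\<close> the rest,
  and coefficients are compared one power at a time.\<close>

lemma slope_poly_eq:
  "slope_poly m x R =
     2 * (2 * (1 - x) * R + 2 * m * x * (R + 1)) * P_poly x R * R * (R + 1) * (R + x)
     - 2 * x * N_poly m x R * R * (R + 1) * (R + x)\<^sup>2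
     - N_poly m x R * P_poly x R * ((2 * R + 1) * (R + x) + 2 * R * (R + 1))"
  (is "_ = ?rhs")
proof -
  define n where "n = 1 - x + m * x"
  define E where "E = 2 * (2 * (1 - x) * R + 2 * m * x * (R + 1)) * (R * (R + 1) * (R + x))
    - N_poly m x R * ((2 * R + 1) * (R + x) + 2 * R * (R + 1))"
  define W where "W = 2 * x * N_poly m x R * (R * (R + 1) * (R + x)\<^sup>2)"
  define e1 e2 e3 where "e1 = - 3 * m * x"
    and "e2 = 3 * x * (n - 2 * m)" and "e3 = n * (2 * x + 1) - 4 * m * x"
  define p where "p = (1 - x) ^ 3 - x ^ 3"
  \<comment> \<open>The terms in \<open>R ^ 4\<close> cancel, so \<open>E\<close> is at most cubic
    and \<open>P_poly x R * E\<close> has degree at most 5; the sixth power comes from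
    \<open>W\<close>.\<close>
  have E: "E = - m * x\<^sup>2 + e1 * R + e2 * R\<^sup>2 + e3 * R ^ 3"
    unfolding E_def N_poly_def e1_def e2_def e3_def n_def by algebra
  have P: "P_poly x R = p - 2 * x\<^sup>2 * R - x * R\<^sup>2"
    unfolding P_poly_def p_def by algebra
  have N: "N_poly m x R = m * x + 2 * m * x * R + n * R\<^sup>2"
    unfolding N_poly_def n_def by algebra
  \<comment> \<open>Coefficients of \<open>N_poly m x R * (R + 1) * (R + x)^2\<close>; the extra
    factor \<open>R\<close> in \<open>W\<close> shifts every index by one.\<close>
  define w where "w = (\<lambda>i. [m * x ^ 3,
      m * x * (x\<^sup>2 + 2 * x) + 2 * m * x ^ 3,
      m * x * (2 * x + 1) + 2 * m * x * (x\<^sup>2 + 2 * x) + n * x\<^sup>2,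
      m * x + 2 * m * x * (2 * x + 1) + n * (x\<^sup>2 + 2 * x),
      2 * m * x + n * (2 * x + 1), n] ! i)"

  have W: "W = 2 * x * (w 0 * R + w 1 * R\<^sup>2 + w 2 * R ^ 3 + w 3 * R ^ 4 + w 4 * R ^ 5 + w 5 * R ^ 6)"
    unfolding W_def N w_def by simp algebra
  have "?rhs = P_poly x R * E - W"
    unfolding E_def W_def by algebra
  also have "\<dots> = - m * x\<^sup>2 * p
      + (e1 * p + 2 * m * x ^ 4 - 2 * x * w 0) * R
      + (e2 * p - 2 * e1 * x\<^sup>2 + m * x ^ 3 - 2 * x * w 1) * R\<^sup>2
      + (e3 * p - 2 * e2 * x\<^sup>2 - e1 * x - 2 * x * w 2) * R ^ 3
      - (2 * e3 * x\<^sup>2 + e2 * x + 2 * x * w 3) * R ^ 4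
      - (e3 * x + 2 * x * w 4) * R ^ 5
      - 2 * x * w 5 * R ^ 6"
    unfolding E P W by algebra
  also have "\<dots> = slope_poly m x R"
  proof -
    have "- m * x\<^sup>2 * p = - slope_coeff m x 0"
      unfolding p_def slope_coeff_def by simp algebra
    moreover have "e1 * p + 2 * m * x ^ 4 - 2 * x * w 0 = - slope_coeff m x 1"
      unfolding p_def slope_coeff_def e1_def w_def by simp algebra
    moreover have "e2 * p - 2 * e1 * x\<^sup>2 + m * x ^ 3 - 2 * x * w 1 = - slope_coeff m x 2"
      unfolding p_def slope_coeff_def e1_def e2_def w_def n_def by simp algebra
    moreover have "e3 * p - 2 * e2 * x\<^sup>2 - e1 * x - 2 * x * w 2 = - slope_coeff m x 3"
      unfolding p_def slope_coeff_def slope_coeff3_def e1_def e2_def e3_def w_def n_def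
      by simp algebra
    moreover have "2 * e3 * x\<^sup>2 + e2 * x + 2 * x * w 3 = slope_coeff m x 4"
      unfolding slope_coeff_def e2_def e3_def w_def n_def by simp algebra
    moreover have "e3 * x + 2 * x * w 4 = slope_coeff m x 5"
      unfolding slope_coeff_def e3_def w_def n_def by simp algebra
    moreover have "2 * x * w 5 = slope_coeff m x 6"
      unfolding slope_coeff_def w_def n_def by simp algebra
    ultimately show ?thesis
      unfolding slope_poly_def sum_atMost_6 by simp
  qed
  finally show ?thesis ..
qed

text \<open>These coefficients are built from positive factors by sums and products, except that the
  quadratic one contains a difference. There \<open>1 \<le> m\<close> allows \<open>m\<close> to be
  lowered to 1, which leaves \<open>1 - x\<close>.\<close>

lemma slope_coeff_pos:
  assumes "0 < x" "x < 1/2" "1 \<le> m" "i \<le> 6" "i \<noteq> 3"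
  shows "slope_coeff m x i > 0"
proof -
  have q: "1 - x + x\<^sup>2 > 0" using assms by (simp add: add_pos_nonneg)
  have "1 - x + (1 - x) * (1 - x + x\<^sup>2) > 0" using assms q by (simp add: add_pos_pos)
  also have "1 - x + (1 - x) * (1 - x + x\<^sup>2) = 2 - 3*x + 2*x\<^sup>2 - x^3"
    by (simp add: algebra_simps power2_eq_square power3_eq_cube)
  finally have c: "2 - 3*x + 2*x\<^sup>2 - x^3 > 0" .
  have "m * (2 - 3*x + 2*x\<^sup>2 - x^3) \<ge> 1 * (2 - 3*x + 2*x\<^sup>2 - x^3)"
    using c assms by (intro mult_right_mono) auto
  moreover have "1 * (2 - 3*x + 2*x\<^sup>2 - x^3) - (1 - x) * (1 - x + x\<^sup>2) = 1 - x"
    by (simp add: algebra_simps power2_eq_square power3_eq_cube)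
  ultimately have d: "m * (2 - 3*x + 2*x\<^sup>2 - x^3) - (1 - x) * (1 - x + x\<^sup>2) > 0"
    using assms by linarith
  have "i \<in> {0,1,2,4,5,6}" using assms by auto
  then show ?thesis
    using assms q d
    by (auto simp: slope_coeff_def numeral_eq_Suc intro!: mult_pos_pos add_pos_pos)
qed

section \<open>The squared angular momentum as a rational function of \<open>R\<close>\<close>

text \<open>\<open>r^2 + B\<close>, \<open>r\<close>, \<open>r + x1\<close> and
  \<open>x2 - r\<close> all become quotients by powers of \<open>R + 1\<close>; these powers cancel
  to a single factor in the denominator.\<close>

lemma L_sq_eq:
  assumes "M > 0" "0 < x" "x < 1" "R > 0"
  shows "L_sq M x (1 - x) R =
    (N_poly (1 / M) x R)\<^sup>2 * P_poly x R / ((1 - x) * (R * (R + 1) * (R + x)\<^sup>2))"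
proof -
  define y where "y = 1 - x"
  define r where "r = y * (R / (R + 1))"
  let ?N = "N_poly (1 / M) x R"
  have pos: "y > 0" "R + 1 > 0" "R + x > 0" using assms by (auto simp: y_def)
  have x: "x = 1 - y" by (simp add: y_def)
  have B: "r\<^sup>2 + inertia_B M x y = y * ?N / (R + 1)\<^sup>2"
  proof -
    have "y * ?N = (y * R)\<^sup>2 + x * y / M * (R + 1)\<^sup>2"
      unfolding N_poly_def y_def[symmetric] by (simp add: algebra_simps power2_eq_square)
    then show ?thesis
      using pos by (simp add: r_def inertia_B_def power_divide add_divide_distrib)
  qed
  have rx: "r + x = (R + x) / (R + 1)" and yr: "y - r = y / (R + 1)"
    using pos by (simp_all add: r_def x field_simps)
  have "L_sq M x y R = (y * ?N / (R + 1)\<^sup>2)\<^sup>2 / r * (y / ((R + x) / (R + 1))\<^sup>2 - x / (y / (R + 1))\<^sup>2)"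
    unfolding L_sq_def Let_def r_def[symmetric] B rx yr ..
  also have "\<dots> = ?N\<^sup>2 * (y ^ 3 - x * (R + x)\<^sup>2) / (y * (R * (R + 1) * (R + x)\<^sup>2))"
    unfolding r_def using pos \<open>R > 0\<close>
    by (simp add: divide_simps) algebra
  finally show ?thesis by (simp add: P_poly_def y_def)
qed

lemma L_sq_has_derivative:
  assumes "M > 0" "0 < x" "x < 1" "R > 0"
  shows "(L_sq M x (1 - x) has_real_derivative
    N_poly (1 / M) x R * (R + x) / ((1 - x) * (R * (R + 1) * (R + x)\<^sup>2)\<^sup>2) * slope_poly (1 / M) x R) (at R)"
proof -
  define m where "m = 1 / M"
  define D where "D = (\<lambda>R. R * (R + 1) * (R + x)\<^sup>2)"
  define N where "N = N_poly m x"
  define P where "P = P_poly x"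
  define N' where "N' = 2 * (1 - x) * R + 2 * m * x * (R + 1)"
  define D' where "D' = (2 * R + 1) * (R + x)\<^sup>2 + 2 * R * (R + 1) * (R + x)"
  have D0: "D R \<noteq> 0" using assms by (simp add: D_def)
  have N: "(N has_real_derivative N') (at R)"
    unfolding N_def N_poly_def N'_def
    by (auto intro!: derivative_eq_intros simp: algebra_simps)
  have P: "(P has_real_derivative - 2 * x * (R + x)) (at R)"
    unfolding P_def P_poly_def
    by (auto intro!: derivative_eq_intros simp: algebra_simps)
  have D: "(D has_real_derivative D') (at R)"
    unfolding D_def D'_def
    by (auto intro!: derivative_eq_intros simp: algebra_simps power2_eq_square)
  have "((\<lambda>R. (N R)\<^sup>2 * P R / ((1 - x) * D R)) has_real_derivative
      ((2 * N R * N' * P R + (N R)\<^sup>2 * (- 2 * x * (R + x))) * ((1 - x) * D R)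
        - (N R)\<^sup>2 * P R * ((1 - x) * D')) / (((1 - x) * D R) * ((1 - x) * D R))) (at R)"
    by (rule derivative_eq_intros N P D refl)+ (use D0 assms in \<open>auto simp: algebra_simps\<close>)
  also have "((2 * N R * N' * P R + (N R)\<^sup>2 * (- 2 * x * (R + x))) * ((1 - x) * D R)
        - (N R)\<^sup>2 * P R * ((1 - x) * D')) / (((1 - x) * D R) * ((1 - x) * D R)) =
      ((2 * N R * N' * P R + (N R)\<^sup>2 * (- 2 * x * (R + x))) * D R - (N R)\<^sup>2 * P R * D')
        / ((1 - x) * (D R)\<^sup>2)"
    using D0 assms by (simp add: divide_simps) algebra
  also have "(2 * N R * N' * P R + (N R)\<^sup>2 * (- 2 * x * (R + x))) * D R - (N R)\<^sup>2 * P R * D' =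
      N R * (R + x) * slope_poly m x R"
    unfolding slope_poly_eq N_def[symmetric] P_def[symmetric] N'_def[symmetric] D'_def D_def
    by algebra
  finally have "((\<lambda>R. (N R)\<^sup>2 * P R / ((1 - x) * D R)) has_real_derivative
      N R * (R + x) / ((1 - x) * (D R)\<^sup>2) * slope_poly m x R) (at R)"
    by simp
  \<comment> \<open>The rational formula is known for positive arguments, so the derivative is
    carried over on a neighbourhood of \<open>R\<close> inside the half line.\<close>
  moreover have "\<forall>\<^sub>F u in nhds R. L_sq M x (1 - x) u = (N u)\<^sup>2 * P u / ((1 - x) * D u)"
    using eventually_nhds_in_open[of "{0<..}" R] assms
    by (auto elim!: eventually_mono simp: L_sq_eq m_def N_def P_def D_def)
  ultimately show ?thesis
    unfolding m_def[symmetric] N_def D_def by (subst DERIV_cong_ev) auto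
qed

lemma N_poly_pos: "0 < x \<Longrightarrow> x < 1 \<Longrightarrow> 0 < m \<Longrightarrow> 0 < R \<Longrightarrow> 0 < N_poly m x R"
  by (auto simp: N_poly_def intro!: add_pos_pos mult_pos_pos)

text \<open>Hides the explicit positive factor, so that the sign of the derivative can be read off
  \<open>slope_poly\<close>.\<close>

lemma L_sq_derivative_pos_multiple:
  assumes "M > 0" "0 < x" "x < 1" "R > 0"
  shows "\<exists>c>0. (L_sq M x (1 - x) has_real_derivative c * slope_poly (1 / M) x R) (at R)"
proof (intro exI conjI)
  show "0 < N_poly (1 / M) x R * (R + x) / ((1 - x) * (R * (R + 1) * (R + x)\<^sup>2)\<^sup>2)"
    using assms N_poly_pos[of x "1 / M" R] by (intro divide_pos_pos mult_pos_pos) auto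
qed (rule L_sq_has_derivative[OF assms])

text \<open>Near 0 the denominator tends to 0 from above while the numerator has a positive limit,
  because \<open>x < 1/2\<close> gives \<open>x ^ 3 < (1 - x) ^ 3\<close>. At infinity a numerator
  of degree 6 with negative leading coefficient beats a denominator of degree 4.\<close>

lemma filterlim_L_sq:
  assumes "M > 0" "0 < x" "x < 1 / 2"
  shows "filterlim (L_sq M x (1 - x)) at_top (at_right 0)"
    and "filterlim (L_sq M x (1 - x)) at_bot at_top"
proof -
  \<comment> \<open>The coefficients get names with known signs for \<open>real_asymp\<close>. Here
    \<open>m\<close> stands for \<open>x / M\<close>, not for \<open>1 / M\<close>.\<close>
  define m k y n where "m = 1 / M * x" and "k = (1 - x) ^ 3 - x ^ 3" and "y = 1 - x" and "n = y + m"
  let ?f = "\<lambda>R. (n * R\<^sup>2 + 2 * m * R + m)\<^sup>2 * (k - 2 * x * x * R - x * R\<^sup>2) / (y * (R * (R + 1) * (R + x)\<^sup>2))"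
  have eq: "?f R = L_sq M x (1 - x) R" if "R > 0" for R
  proof -
    have "k - 2 * x * x * R - x * R\<^sup>2 = P_poly x R"
      unfolding k_def P_poly_def by algebra
    moreover have "n * R\<^sup>2 + 2 * m * R + m = N_poly (1 / M) x R"
      unfolding n_def y_def m_def N_poly_def by algebra
    ultimately show ?thesis
      using that assms by (simp add: L_sq_eq y_def)
  qed
  have pos: "m > 0" "y > 0" "x > 0" "n > 0"
    using assms by (auto simp: m_def y_def n_def intro: add_pos_pos)
  have "x ^ 3 < (1 - x) ^ 3" using assms by (intro power_strict_mono) auto
  then have k: "k > 0" by (simp add: k_def)
  have "filterlim ?f at_top (at_right 0)" using pos k by real_asymp
  moreover have "\<forall>\<^sub>F R in at_right 0. ?f R = L_sq M x (1 - x) R"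
    using eq by (auto simp: eventually_at_right_less intro: eventually_mono[OF eventually_at_right_less])
  ultimately show "filterlim (L_sq M x (1 - x)) at_top (at_right 0)"
    by (rule filterlim_mono_eventually[OF _ order_refl order_refl])
  have "filterlim ?f at_bot at_top" using pos k by real_asymp
  moreover have "\<forall>\<^sub>F R in at_top. ?f R = L_sq M x (1 - x) R"
    using eq by (auto intro: eventually_mono[OF eventually_gt_at_top[of 0]])
  ultimately show "filterlim (L_sq M x (1 - x)) at_bot at_top"
    by (rule filterlim_mono_eventually[OF _ order_refl order_refl])
qed

section \<open>Relative equilibria as solutions of a level equation\<close>

text \<open>Both distances depend on the angle through its cosine, which is stationary at 0, so the
  derivative there is purely radial.\<close>

lemma amended_potential_has_derivative:
  assumes "M > 0" "0 < x1" "0 < x2" "0 < r" "r < x2"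
  shows "((\<lambda>(r, \<theta>). amended_potential M x1 x2 L r \<theta>) has_derivative
    (\<lambda>v. (x2 / (r + x1)\<^sup>2 - x1 / (x2 - r)\<^sup>2 - L\<^sup>2 * r / (r\<^sup>2 + inertia_B M x1 x2)\<^sup>2) * fst v)) (at (r, 0))"
proof -
  have B: "inertia_B M x1 x2 > 0" using assms by (simp add: inertia_B_def)
  then have B': "r\<^sup>2 + inertia_B M x1 x2 > 0" using assms by (simp add: add_nonneg_pos)
  \<comment> \<open>At angle 0 the radicands are perfect squares; \<open>r < x2\<close> selects the
    root \<open>x2 - r\<close>, whence \<open>dist1\<close> has radial derivative -1.\<close>
  have s1: "r\<^sup>2 - 2 * x2 * r + x2\<^sup>2 = (x2 - r)\<^sup>2" by algebra
  have s2: "r\<^sup>2 + 2 * x1 * r + x1\<^sup>2 = (r + x1)\<^sup>2" by algebra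
  have d1: "((\<lambda>p. dist1 x2 (fst p) (snd p)) has_derivative (\<lambda>v. - fst v)) (at (r, 0))"
    unfolding dist1_def
    apply (rule derivative_eq_intros refl)+
    using assms apply (simp add: s1)
    apply (rule derivative_eq_intros refl)+
    using assms apply (simp add: s1 fun_eq_iff)
    apply (simp add: divide_simps)
    apply (simp add: algebra_simps)
    done
  have d2: "((\<lambda>p. dist2 x1 (fst p) (snd p)) has_derivative (\<lambda>v. fst v)) (at (r, 0))"
    unfolding dist2_def
    apply (rule derivative_eq_intros refl)+
    using assms apply (simp add: s2)
    apply (rule derivative_eq_intros refl)+
    using assms apply (simp add: s2 fun_eq_iff)
    apply (simp add: divide_simps)
    apply (simp add: algebra_simps)
    done
  have v1: "dist1 x2 r 0 = x2 - r" using assms by (simp add: dist1_def s1)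
  have v2: "dist2 x1 r 0 = r + x1" using assms by (simp add: dist2_def s2)
  have "((\<lambda>p. x1 / dist1 x2 (fst p) (snd p)) has_derivative (\<lambda>v. x1 / (x2 - r)\<^sup>2 * fst v)) (at (r, 0))"
    using has_derivative_divide[OF has_derivative_const d1, of x1] assms
    by (simp add: v1 power2_eq_square inverse_eq_divide)
  moreover have "((\<lambda>p. x2 / dist2 x1 (fst p) (snd p)) has_derivative (\<lambda>v. - (x2 / (r + x1)\<^sup>2) * fst v)) (at (r, 0))"
    using has_derivative_divide[OF has_derivative_const d2, of x2] assms
    by (simp add: v2 power2_eq_square inverse_eq_divide)
  moreover have "((\<lambda>p. L\<^sup>2 / (2 * ((fst p)\<^sup>2 + inertia_B M x1 x2))) has_derivative
      (\<lambda>v. - (L\<^sup>2 * r / (r\<^sup>2 + inertia_B M x1 x2)\<^sup>2) * fst v)) (at (r, 0::real))"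
    apply (rule derivative_eq_intros refl)+
    using B' apply simp
    using B' apply (simp add: fun_eq_iff divide_simps)
    apply (simp add: power2_eq_square algebra_simps)
    done
  ultimately have "((\<lambda>p. L\<^sup>2 / (2 * ((fst p)\<^sup>2 + inertia_B M x1 x2))
      - x1 / dist1 x2 (fst p) (snd p) - x2 / dist2 x1 (fst p) (snd p)) has_derivative
      (\<lambda>v. - (L\<^sup>2 * r / (r\<^sup>2 + inertia_B M x1 x2)\<^sup>2) * fst v
        - x1 / (x2 - r)\<^sup>2 * fst v - - (x2 / (r + x1)\<^sup>2) * fst v)) (at (r, 0))"
    by (intro has_derivative_diff)
  then show ?thesis
    unfolding amended_potential_def case_prod_beta by (simp add: algebra_simps)
qed

text \<open>The total derivative is a scalar multiple of the radial projection, so it vanishes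
  exactly when the scalar does; solving for \<open>L^2\<close> gives the equation.\<close>

lemma relative_equilibrium_colinear_iff:
  assumes "M > 0" "0 < x1" "0 < x2" "0 < r" "r < x2"
  shows "relative_equilibrium M x1 x2 L (r, 0) \<longleftrightarrow>
    (r\<^sup>2 + inertia_B M x1 x2)\<^sup>2 / r * (x2 / (r + x1)\<^sup>2 - x1 / (x2 - r)\<^sup>2) = L\<^sup>2"
proof -
  define b C where "b = r\<^sup>2 + inertia_B M x1 x2"
    and "C = x2 / (r + x1)\<^sup>2 - x1 / (x2 - r)\<^sup>2"
  have b: "b > 0" unfolding b_def inertia_B_def using assms by (intro add_nonneg_pos) auto
  have der: "((\<lambda>(r, \<theta>). amended_potential M x1 x2 L r \<theta>) has_derivative
      (\<lambda>v. (C - L\<^sup>2 * r / b\<^sup>2) * fst v)) (at (r, 0))"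
    using amended_potential_has_derivative[OF assms] by (simp add: C_def b_def)
  have "relative_equilibrium M x1 x2 L (r, 0) \<longleftrightarrow> C - L\<^sup>2 * r / b\<^sup>2 = 0"
  proof
    assume "relative_equilibrium M x1 x2 L (r, 0)"
    then have "(\<lambda>v::real \<times> real. (C - L\<^sup>2 * r / b\<^sup>2) * fst v) = (\<lambda>_. 0)"
      using has_derivative_unique[OF der] by (simp add: relative_equilibrium_def)
    from fun_cong[OF this, of "(1, 0)"] show "C - L\<^sup>2 * r / b\<^sup>2 = 0" by simp
  next
    assume "C - L\<^sup>2 * r / b\<^sup>2 = 0"
    with der show "relative_equilibrium M x1 x2 L (r, 0)"
      using assms by (simp add: relative_equilibrium_def)
  qed
  also have "\<dots> \<longleftrightarrow> b\<^sup>2 / r * C = L\<^sup>2"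
    using b assms by (auto simp: field_simps)
  finally show ?thesis by (simp add: b_def C_def)
qed

text \<open>The substitution \<open>r = x2 * R / (R + 1)\<close> maps the positive half line
  bijectively onto the overlapped positions, with inverse \<open>R = r / (x2 - r)\<close>.\<close>

lemma card_colinear_overlapped_RE:
  assumes "M > 0" "0 < x" "x < 1"
  shows "card (colinear_overlapped_RE M x (1 - x) L) = card {R. 0 < R \<and> L_sq M x (1 - x) R = L\<^sup>2}"
proof -
  define y where "y = 1 - x"
  have y: "y > 0" using assms by (simp add: y_def)
  let ?g = "\<lambda>R. (y * (R / (R + 1)), 0 :: real)"
  let ?S = "{R. 0 < R \<and> L_sq M x y R = L\<^sup>2}"
  have RE: "relative_equilibrium M x y L (?g R) \<longleftrightarrow> L_sq M x y R = L\<^sup>2" if "R > 0" for R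
  proof -
    have "y * (R / (R + 1)) < y" using that y by (simp add: field_simps)
    then show ?thesis
      unfolding L_sq_def Let_def
      using that y assms by (intro relative_equilibrium_colinear_iff) auto
  qed
  have "colinear_overlapped_RE M x y L = ?g ` ?S"
  proof (intro equalityI subsetI)
    fix p assume "p \<in> colinear_overlapped_RE M x y L"
    then obtain r where p: "p = (r, 0)" and r: "0 < r" "r < y"
      and eq: "relative_equilibrium M x y L (r, 0)"
      by (auto simp: colinear_overlapped_RE_def relative_equilibrium_def)
    have R: "r / (y - r) > 0" using r by simp
    have "y * ((r / (y - r)) / (r / (y - r) + 1)) = r" using r by (simp add: field_simps)
    then have g: "?g (r / (y - r)) = p" by (simp add: p)
    then have "L_sq M x y (r / (y - r)) = L\<^sup>2" using RE[OF R] eq p by simp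
    then show "p \<in> ?g ` ?S" using R g by (intro image_eqI[of _ _ "r / (y - r)"]) auto
  next
    fix p assume "p \<in> ?g ` ?S"
    then obtain R where R: "0 < R" "L_sq M x y R = L\<^sup>2" "p = ?g R" by blast
    have "y * (R / (R + 1)) < y" using R y by (simp add: field_simps)
    then show "p \<in> colinear_overlapped_RE M x y L"
      using R RE[of R] by (simp add: colinear_overlapped_RE_def)
  qed
  moreover have "inj_on ?g ?S"
    using y by (auto intro!: inj_onI simp: field_simps)
  ultimately show ?thesis by (simp add: card_image y_def)
qed

section \<open>Sign of the slope polynomial on the half line\<close>

lemma slope_poly_neg:
  assumes "0 < x" "x < 1/2" "1 \<le> m" "slope_coeff3 m x < 0" "R > 0"
  shows "slope_poly m x R < 0"
proof -
  have "slope_coeff m x i > 0" if "i \<le> 6" for i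
    using slope_coeff_pos[OF assms(1-3) that] assms(4)
    by (cases "i = 3") (auto simp: slope_coeff_def)
  then have "(\<Sum>i\<le>6. slope_coeff m x i * R ^ i) > 0"
    using assms(5) by (intro sum_pos) auto
  then show ?thesis by (simp add: slope_poly_def)
qed

text \<open>The cubic term is the only one that may be positive, so the quotient by \<open>R ^ 3\<close> is concave.\<close>

lemma slope_poly_sign_pattern:
  assumes "0 < x" "x < 1/2" "1 \<le> m" "slope_poly m x 1 > 0"
  obtains p q where "0 < p" "p < 1" "1 < q"
    "\<And>R. 0 < R \<Longrightarrow> R < p \<Longrightarrow> slope_poly m x R < 0"
    "\<And>R. p < R \<Longrightarrow> R < q \<Longrightarrow> slope_poly m x R > 0"
    "\<And>R. q < R \<Longrightarrow> slope_poly m x R < 0"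
    "slope_poly m x p = 0" "slope_poly m x q = 0"
proof -
  define c where "c = slope_coeff m x"
  have c: "c 0 > 0" "c 1 > 0" "c 2 > 0" "c 4 > 0" "c 5 > 0" "c 6 > 0"
    using slope_coeff_pos[OF assms(1-3)] by (auto simp: c_def)
  \<comment> \<open>Dividing the negated polynomial by \<open>R ^ 3\<close> moves the coefficient of
    uncertain sign into the constant term, which does not affect convexity.\<close>
  define f where "f = (\<lambda>R. c 0 / R ^ 3 + c 1 / R\<^sup>2 + c 2 / R + c 3 + c 4 * R + c 5 * R\<^sup>2 + c 6 * R ^ 3)"
  have slope: "slope_poly m x R = - (R ^ 3 * f R)" if "R > 0" for R
  proof -
    have "R ^ 3 * f R = c 0 + c 1 * R + c 2 * R\<^sup>2 + c 3 * R ^ 3 + c 4 * R ^ 4 + c 5 * R ^ 5 + c 6 * R ^ 6"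
      using that by (simp add: f_def distrib_left eval_nat_numeral)
    then show ?thesis by (simp add: slope_poly_def sum_atMost_6 c_def)
  qed
  define f' where "f' = (\<lambda>R. - 3 * c 0 / R ^ 4 - 2 * c 1 / R ^ 3 - c 2 / R\<^sup>2 + c 4 + 2 * c 5 * R + 3 * c 6 * R\<^sup>2)"
  have f': "(f has_real_derivative f' R) (at R)" if "R > 0" for R
    unfolding f_def f'_def using that
    by (auto intro!: derivative_eq_intros simp: field_simps eval_nat_numeral)
  have f'': "(f' has_real_derivative
      12 * c 0 / R ^ 5 + 6 * c 1 / R ^ 4 + 2 * c 2 / R ^ 3 + 2 * c 5 + 6 * c 6 * R) (at R)" if "R > 0" for R
    unfolding f'_def using that
    by (auto intro!: derivative_eq_intros simp: field_simps eval_nat_numeral)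
  have "convex_on {0<..} f"
    by (rule f''_ge0_imp_convex[OF _ f' f'']) (use c in \<open>auto simp: less_imp_le intro!: add_nonneg_nonneg\<close>)
  moreover have "continuous_on {0<..} f"
    using f' by (intro DERIV_continuous_on) (auto intro: has_field_derivative_at_within)
  \<comment> \<open>The minimum gives \<open>c 0 / u\<close> at least \<open>|c 3| + 1\<close>, and
    \<open>u < 1\<close> makes \<open>c 0 / u ^ 3\<close> no smaller, so the first term of
    \<open>f u\<close> outweighs \<open>c 3\<close>.\<close>
  moreover define u where "u = min (1 / 2) (c 0 / (\<bar>c 3\<bar> + 1))"
  have u: "0 < u" "u < 1" using c by (auto simp: u_def)
  moreover have "f u > 0"
  proof -
    have "u ^ 3 \<le> u" using u power_decreasing[of 1 3 u] by simp
    have "\<bar>c 3\<bar> + 1 \<le> c 0 / u"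
      using u(1) c min.cobounded2[of "1/2" "c 0 / (\<bar>c 3\<bar> + 1)"] unfolding u_def[symmetric]
      by (simp add: pos_le_divide_eq mult.commute add_pos_nonneg)
    also have "\<dots> \<le> c 0 / u ^ 3"
      using \<open>u ^ 3 \<le> u\<close> u c by (intro divide_left_mono) auto
    finally have "c 0 / u ^ 3 + c 3 > 0" by linarith
    moreover have "c 1 / u\<^sup>2 > 0" "c 2 / u > 0" "c 4 * u > 0" "c 5 * u\<^sup>2 > 0" "c 6 * u ^ 3 > 0"
      using u c by auto
    ultimately show ?thesis unfolding f_def by linarith
  qed
  \<comment> \<open>Chosen so that \<open>c 4 * w = 2 * c 4 + |c 3|\<close> outweighs
    \<open>c 3\<close>; the summand 2 puts \<open>w\<close> beyond 1.\<close>
  moreover define w where "w = 2 + \<bar>c 3\<bar> / c 4"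
  have w: "1 < w" using c by (simp add: w_def add_pos_nonneg)
  moreover have "f w > 0"
  proof -
    have "c 4 * w = 2 * c 4 + \<bar>c 3\<bar>" using c by (simp add: w_def distrib_left)
    then have "c 4 * w + c 3 > 0" using c by linarith
    moreover have "c 0 / w ^ 3 > 0" "c 1 / w\<^sup>2 > 0" "c 2 / w > 0" "c 5 * w\<^sup>2 > 0" "c 6 * w ^ 3 > 0"
      using w c by auto
    ultimately show ?thesis unfolding f_def by linarith
  qed
  moreover have "f 1 < 0" using assms(4) slope[of 1] by simp
  ultimately obtain p q where "0 < p" "p < 1" "1 < q" "f p = 0" "f q = 0"
    "\<And>r. p < r \<Longrightarrow> r < q \<Longrightarrow> f r < 0"
    "\<And>r. 0 < r \<Longrightarrow> r < p \<Longrightarrow> f r > 0" "\<And>r. q < r \<Longrightarrow> f r > 0"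
    using convex_sign_pattern[of f u 1 w] by blast
  then show thesis
    by (intro that[of p q]) (auto simp: slope mult_less_0_iff zero_less_mult_iff)
qed

section \<open>From the sign of the slope to the number of equilibria\<close>

context
  fixes M x :: real
  assumes M: "0 < M" "M < 1" and x: "0 < x" "x < 1/2"
begin

lemma half_line_profile_L_sq: "half_line_profile (L_sq M x (1 - x))"
proof
  show "continuous_on {0<..} (L_sq M x (1 - x))"
    by (rule DERIV_continuous_on, rule has_field_derivative_at_within, rule L_sq_has_derivative)
      (use M x in auto)
qed (use filterlim_L_sq M x in auto)

lemma continuous_on_L_sq: "0 < u \<Longrightarrow> continuous_on {u..v} (L_sq M x (1 - x))"
  by (rule continuous_on_subset[OF half_line_profile.cont[OF half_line_profile_L_sq]]) auto

text \<open>The sign is demanded inside the interval, so that its endpoints may be zeros of the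
  slope polynomial, as the turning points are.\<close>

lemma L_sq_decreasing:
  assumes "0 < u" "u < v" "\<And>R. u < R \<Longrightarrow> R < v \<Longrightarrow> slope_poly (1 / M) x R < 0"
  shows "L_sq M x (1 - x) v < L_sq M x (1 - x) u"
proof (rule DERIV_neg_imp_decreasing_open[OF \<open>u < v\<close> _ continuous_on_L_sq[OF \<open>0 < u\<close>]])
  fix R assume R: "u < R" "R < v"
  then have "0 < R" using \<open>0 < u\<close> by simp
  then obtain c where "c > 0" "(L_sq M x (1 - x) has_real_derivative c * slope_poly (1 / M) x R) (at R)"
    using L_sq_derivative_pos_multiple[of M x R] M x by auto
  then show "\<exists>y. (L_sq M x (1 - x) has_real_derivative y) (at R) \<and> y < 0"
    using assms(3)[OF R] by (auto intro: mult_pos_neg)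
qed

lemma L_sq_increasing:
  assumes "0 < u" "u < v" "\<And>R. u < R \<Longrightarrow> R < v \<Longrightarrow> slope_poly (1 / M) x R > 0"
  shows "L_sq M x (1 - x) u < L_sq M x (1 - x) v"
proof (rule DERIV_pos_imp_increasing_open[OF \<open>u < v\<close> _ continuous_on_L_sq[OF \<open>0 < u\<close>]])
  fix R assume R: "u < R" "R < v"
  then have "0 < R" using \<open>0 < u\<close> by simp
  then obtain c where "c > 0" "(L_sq M x (1 - x) has_real_derivative c * slope_poly (1 / M) x R) (at R)"
    using L_sq_derivative_pos_multiple[of M x R] M x by auto
  then show "\<exists>y. (L_sq M x (1 - x) has_real_derivative y) (at R) \<and> y > 0"
    using assms(3)[OF R] by auto
qed

lemma unique_RE_if_slope_coeff3_neg:
  assumes "slope_coeff3 (1 / M) x < 0"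
  shows "R > 0 \<Longrightarrow> deriv (L_sq M x (1 - x)) R < 0"
    and "card (colinear_overlapped_RE M x (1 - x) L) = 1"
proof -
  have neg: "slope_poly (1 / M) x R < 0" if "R > 0" for R
    using slope_poly_neg[of x "1 / M" R] that assms M x by simp
  show "deriv (L_sq M x (1 - x)) R < 0" if "R > 0"
  proof -
    obtain c where "c > 0" "(L_sq M x (1 - x) has_real_derivative c * slope_poly (1 / M) x R) (at R)"
      using L_sq_derivative_pos_multiple[of M x R] \<open>R > 0\<close> M x by auto
    then show ?thesis using neg[OF that] by (simp add: DERIV_imp_deriv mult_pos_neg)
  qed
  show "card (colinear_overlapped_RE M x (1 - x) L) = 1"
    using half_line_profile.card_level_decreasing[OF half_line_profile_L_sq] L_sq_decreasing neg M x
    by (simp add: card_colinear_overlapped_RE)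
qed

text \<open>A positive slope at \<open>R = 1\<close> opens an increasing interval around 1; the
  values of \<open>L_sq\<close> at its ends \<open>p\<close> and \<open>q\<close> are the levels
  \<open>a\<close> and \<open>b\<close>. Positivity of \<open>P_poly x 1\<close> ensures
  \<open>0 \<le> a\<close>, so every level in between is the square of a real
  \<open>L\<close>.\<close>

lemma three_RE_if_slope_pos:
  assumes "slope_poly (1 / M) x 1 > 0" "P_poly x 1 > 0"
  shows "\<exists>p q. 0 < p \<and> p < q \<and> {R. 0 < R \<and> deriv (L_sq M x (1 - x)) R > 0} = {p<..<q}" (is ?interval)
    and "\<exists>a b. 0 \<le> a \<and> a < b \<and>
      (\<forall>L. (a < L\<^sup>2 \<and> L\<^sup>2 < b \<longrightarrow> card (colinear_overlapped_RE M x (1 - x) L) = 3) \<and>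
           (L\<^sup>2 = a \<or> L\<^sup>2 = b \<longrightarrow> card (colinear_overlapped_RE M x (1 - x) L) = 2) \<and>
           (L\<^sup>2 < a \<or> b < L\<^sup>2 \<longrightarrow> card (colinear_overlapped_RE M x (1 - x) L) = 1))" (is ?count)
proof -
  let ?f = "L_sq M x (1 - x)" and ?s = "slope_poly (1 / M) x"
  obtain p q where pq: "0 < p" "p < 1" "1 < q"
    and left: "\<And>R. 0 < R \<Longrightarrow> R < p \<Longrightarrow> ?s R < 0"
    and mid: "\<And>R. p < R \<Longrightarrow> R < q \<Longrightarrow> ?s R > 0"
    and right: "\<And>R. q < R \<Longrightarrow> ?s R < 0" and zero: "?s p = 0" "?s q = 0"
    using slope_poly_sign_pattern[of x "1 / M"] assms M x by auto
  have "?s R > 0 \<longleftrightarrow> p < R \<and> R < q" if "R > 0" for R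
    using left[of R] mid[of R] right[of R] zero that
    by (metis less_asym less_irrefl linorder_neqE_linordered_idom)
  moreover have "deriv ?f R > 0 \<longleftrightarrow> ?s R > 0" if "R > 0" for R
  proof -
    obtain c where "c > 0" "(?f has_real_derivative c * ?s R) (at R)"
      using L_sq_derivative_pos_multiple[of M x R] \<open>R > 0\<close> M x by auto
    then show ?thesis by (simp add: DERIV_imp_deriv zero_less_mult_iff)
  qed
  ultimately have "{R. 0 < R \<and> deriv ?f R > 0} = {p<..<q}"
    using \<open>0 < p\<close> by (auto dest: less_trans)
  then show ?interval using pq by (intro exI[of _ p] exI[of _ q]) simp
  have "p < q" using pq by simp
  have dec_left: "?f v < ?f u" if "0 < u" "u < v" "v \<le> p" for u v
    using that left by (intro L_sq_decreasing) auto
  have inc: "?f u < ?f v" if "p \<le> u" "u < v" "v \<le> q" for u v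
    using that mid pq by (intro L_sq_increasing) auto
  have dec_right: "?f v < ?f u" if "q \<le> u" "u < v" for u v
    using that right pq by (intro L_sq_decreasing) auto
  note count = half_line_profile.card_level_N_shaped[OF half_line_profile_L_sq \<open>0 < p\<close> \<open>p < q\<close>,
      OF dec_left inc dec_right]
  \<comment> \<open>\<open>P_poly x\<close> decreases on the half line and \<open>p < 1\<close>, so
    its value at \<open>p\<close> is at least the positive one at 1.\<close>
  have "(p + x)\<^sup>2 \<le> (1 + x)\<^sup>2" using pq x by (intro power_mono) auto
  then have "x * (p + x)\<^sup>2 \<le> x * (1 + x)\<^sup>2" using x by (intro mult_left_mono) auto
  then have "P_poly x p > 0" using assms(2) by (simp add: P_poly_def)
  then have nonneg: "0 \<le> ?f p" using pq M x by (simp add: L_sq_eq)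
  have less: "?f p < ?f q" using inc[of p q] \<open>p < q\<close> by simp
  have card: "card (colinear_overlapped_RE M x (1 - x) L) = card {R. 0 < R \<and> ?f R = L\<^sup>2}" for L
    using M x by (intro card_colinear_overlapped_RE) auto
  show ?count
    unfolding card
  proof (rule exI[of _ "?f p"], rule exI[of _ "?f q"], intro conjI allI impI)
    fix L :: real
    show "card {R. 0 < R \<and> ?f R = L\<^sup>2} = 3" if "?f p < L\<^sup>2 \<and> L\<^sup>2 < ?f q"
      using that by (intro count(1)) auto
    show "card {R. 0 < R \<and> ?f R = L\<^sup>2} = 2" if "L\<^sup>2 = ?f p \<or> L\<^sup>2 = ?f q"
      using that by (intro count(2)) auto
    show "card {R. 0 < R \<and> ?f R = L\<^sup>2} = 1" if "L\<^sup>2 < ?f p \<or> ?f q < L\<^sup>2"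
      using that by (intro count(3)) auto
  qed (fact nonneg less)+
qed

end

section \<open>The two limiting regimes of the mass ratio\<close>

text \<open>At \<open>x = 1/2\<close> the value is \<open>- (1 + m) / 2\<close>, and continuity
  keeps the sign on a left neighbourhood.\<close>

lemma slope_coeff3_neg_near_half:
  assumes "m > 0"
  obtains c where "c < 1/2" "\<And>x. c < x \<Longrightarrow> x < 1/2 \<Longrightarrow> slope_coeff3 m x < 0"
proof -
  have "((\<lambda>x. slope_coeff3 m x) \<longlongrightarrow> slope_coeff3 m (1/2)) (at_left (1/2))"
    unfolding slope_coeff3_def by (intro tendsto_intros)
  moreover have "slope_coeff3 m (1/2) < 0"
    using assms by (simp add: slope_coeff3_def power_divide field_simps)
  ultimately have "\<forall>\<^sub>F x in at_left (1/2). slope_coeff3 m x < 0"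
    by (rule order_tendstoD)
  then show thesis
    using that eventually_at_left[of 0 "1/2::real"] by auto
qed

text \<open>At \<open>x = 0\<close> both quantities equal 1, and continuity keeps them positive for
  small \<open>x\<close>.\<close>

lemma slope_poly_pos_near_0:
  obtains \<epsilon> where "\<epsilon> > 0" "\<And>x. 0 < x \<Longrightarrow> x < \<epsilon> \<Longrightarrow> slope_poly m x 1 > 0 \<and> P_poly x 1 > 0"
proof -
  have "((\<lambda>x. slope_poly m x 1) \<longlongrightarrow> slope_poly m 0 1) (at_right 0)"
    unfolding slope_poly_eq N_poly_def P_poly_def by (intro tendsto_intros)
  moreover have "((\<lambda>x. P_poly x 1) \<longlongrightarrow> P_poly 0 1) (at_right 0)"
    unfolding P_poly_def by (intro tendsto_intros)
  moreover have "slope_poly m 0 1 > 0" "P_poly 0 1 > 0"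
    by (simp_all add: slope_poly_eq N_poly_def P_poly_def)
  ultimately have "\<forall>\<^sub>F x in at_right 0. slope_poly m x 1 > 0 \<and> P_poly x 1 > 0"
    by (auto intro: eventually_conj order_tendstoD)
  then show thesis
    using that eventually_at_right[of 0 "1::real"] by auto
qed

theorem theorem4p3p3:
  fixes M1 M2 :: real
  assumes "M1 > 0" and "M2 > 0" and "M1 + M2 = 1"
  shows
    "(\<exists>c<1/2. \<forall>x1 x2. 0 < x1 \<and> x1 + x2 = 1 \<and> x1 < x2 \<and> c < x1 \<longrightarrow>
        (\<forall>R>0. deriv (L_sq M1 x1 x2) R < 0) \<and>
        (\<forall>L. card (colinear_overlapped_RE M1 x1 x2 L) = 1))
     \<and>
     (\<exists>\<epsilon>>0. \<forall>x1 x2. 0 < x1 \<and> 0 < x2 \<and> x1 + x2 = 1 \<and> x1 < \<epsilon> * x2 \<longrightarrow>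
        (\<exists>p q. 0 < p \<and> p < q \<and> {R. 0 < R \<and> deriv (L_sq M1 x1 x2) R > 0} = {p<..<q}) \<and>
        (\<exists>a b. 0 \<le> a \<and> a < b \<and>
           (\<forall>L. (a < L\<^sup>2 \<and> L\<^sup>2 < b \<longrightarrow> card (colinear_overlapped_RE M1 x1 x2 L) = 3) \<and>
                (L\<^sup>2 = a \<or> L\<^sup>2 = b \<longrightarrow> card (colinear_overlapped_RE M1 x1 x2 L) = 2) \<and>
                (L\<^sup>2 < a \<or> b < L\<^sup>2 \<longrightarrow> card (colinear_overlapped_RE M1 x1 x2 L) = 1))))"
proof (intro conjI)
  have "1 / M1 > 0" using assms by simp
  then obtain c where c: "c < 1/2" "\<And>x. c < x \<Longrightarrow> x < 1/2 \<Longrightarrow> slope_coeff3 (1 / M1) x < 0"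
    using slope_coeff3_neg_near_half by blast
  show "\<exists>c<1/2. \<forall>x1 x2. 0 < x1 \<and> x1 + x2 = 1 \<and> x1 < x2 \<and> c < x1 \<longrightarrow>
        (\<forall>R>0. deriv (L_sq M1 x1 x2) R < 0) \<and>
        (\<forall>L. card (colinear_overlapped_RE M1 x1 x2 L) = 1)"
  proof (intro exI[of _ c] conjI[OF c(1)] allI impI)
    fix x1 x2 :: real
    assume *: "0 < x1 \<and> x1 + x2 = 1 \<and> x1 < x2 \<and> c < x1"
    then have x2: "x2 = 1 - x1" and "x1 < 1/2" by auto
    then show "(\<forall>R>0. deriv (L_sq M1 x1 x2) R < 0) \<and> (\<forall>L. card (colinear_overlapped_RE M1 x1 x2 L) = 1)"
      using unique_RE_if_slope_coeff3_neg[of M1 x1] c(2)[of x1] * assms by (simp add: x2)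
  qed
next
  obtain \<epsilon> where \<epsilon>: "\<epsilon> > 0"
    "\<And>x. 0 < x \<Longrightarrow> x < \<epsilon> \<Longrightarrow> slope_poly (1 / M1) x 1 > 0 \<and> P_poly x 1 > 0"
    using slope_poly_pos_near_0 by blast
  show "\<exists>\<epsilon>>0. \<forall>x1 x2. 0 < x1 \<and> 0 < x2 \<and> x1 + x2 = 1 \<and> x1 < \<epsilon> * x2 \<longrightarrow>
        (\<exists>p q. 0 < p \<and> p < q \<and> {R. 0 < R \<and> deriv (L_sq M1 x1 x2) R > 0} = {p<..<q}) \<and>
        (\<exists>a b. 0 \<le> a \<and> a < b \<and>
           (\<forall>L. (a < L\<^sup>2 \<and> L\<^sup>2 < b \<longrightarrow> card (colinear_overlapped_RE M1 x1 x2 L) = 3) \<and>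
                (L\<^sup>2 = a \<or> L\<^sup>2 = b \<longrightarrow> card (colinear_overlapped_RE M1 x1 x2 L) = 2) \<and>
                (L\<^sup>2 < a \<or> b < L\<^sup>2 \<longrightarrow> card (colinear_overlapped_RE M1 x1 x2 L) = 1)))"
  \<comment> \<open>The condition bounds the ratio \<open>x1 / x2\<close>; because
    \<open>x2 < 1\<close> it also bounds \<open>x1\<close>, and the \<open>1/2\<close> in the
    minimum secures \<open>x1 < 1/2\<close>.\<close>
  proof (rule exI[of _ "min \<epsilon> (1/2)"], intro conjI allI impI)
    fix x1 x2 :: real
    assume *: "0 < x1 \<and> 0 < x2 \<and> x1 + x2 = 1 \<and> x1 < min \<epsilon> (1/2) * x2"
    then have "min \<epsilon> (1/2) * x2 \<le> min \<epsilon> (1/2)" using \<epsilon> by (intro mult_left_le) auto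
    with * have x: "x1 < \<epsilon>" "x1 < 1/2" "0 < x1" by auto
    have x2: "x2 = 1 - x1" using * by simp
    have M: "0 < M1" "M1 < 1" using assms by auto
    note three = three_RE_if_slope_pos[OF M x(3,2), folded x2] \<epsilon>(2)[OF x(3,1)]
    show "\<exists>p q. 0 < p \<and> p < q \<and> {R. 0 < R \<and> deriv (L_sq M1 x1 x2) R > 0} = {p<..<q}"
      using three(1,3) by blast
    show "\<exists>a b. 0 \<le> a \<and> a < b \<and>
           (\<forall>L. (a < L\<^sup>2 \<and> L\<^sup>2 < b \<longrightarrow> card (colinear_overlapped_RE M1 x1 x2 L) = 3) \<and>
                (L\<^sup>2 = a \<or> L\<^sup>2 = b \<longrightarrow> card (colinear_overlapped_RE M1 x1 x2 L) = 2) \<and>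
                (L\<^sup>2 < a \<or> b < L\<^sup>2 \<longrightarrow> card (colinear_overlapped_RE M1 x1 x2 L) = 1))"
      using three(2,3) by blast
  qed (use \<epsilon> in simp)
qed

end
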